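(* Let $G\subseteq K_{m,n}$ be a bipartite graph with no isolated vertices, and let $G^*\subseteq K_{n,m}$ be its mirror image. The number of lattice points in the polytope $P_G^-(1,\dots,1)$ equals the number of lattice points in the polytope $P_{G^*}^-(1,\dots,1)$: $$\#\bigl(P_G^-(1,\dots,1)\cap\mathbb{Z}^n\bigr)=\#\bigl(P_{G^*}^-(1,\dots,1)\cap\mathbb{Z}^m\bigr).$$
   Context: $[n]=\{1,\dots,n\}$; $m,n\ge1$. The vertices of $G\subseteq K_{m,n}$ are labeled $1,\dots,m$ (left) and $\bar1,\dots,\bar n$ (right). Let $I_i=\{j\in[n]\mid(i,\bar j)\text{ is an edge of }G\}$ for $i=1,\dots,m$. For nonempty $I\subseteq[n]$, $\Delta_I=\mathrm{ConvexHull}(e_i\mid i\in I)\subset\mathbb{R}^n$, with $e_i$ the coordinate vectors. Let $P_G(1,\dots,1)=\Delta_{I_1}+\cdots+\Delta_{I_m}\subset\mathbb{R}^n$ (Minkowski sum), and let the trimmed generalized permutohedron be $P_G^-(1,\dots,1)=\{x\in\mathbb{R}^n\mid x+\Delta_{[n]}\subseteq P_G(1,\dots,1)\}$. The mirror image $G^*\subseteq K_{n,m}$ is the same graph with left and right parts switched, i.e. $(j,\bar i)$ is an edge of $G^*$ if and only if $(i,\bar j)$ is an edge of $G$; thus $P_{G^*}^-(1,\dots,1)\subset\mathbb{R}^m$ is defined in the same way using the sets $I_j^*=\{i\in[m]\mid(i,\bar j)\in G\}$, $j=1,\dots,n$, and the simplex $\Delta_{[m]}$. *)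

theory Defs
  imports "HOL-Analysis.Analysis" "HOL-Library.Set_Algebras"
begin

text \<open>
  A bipartite graph \<open>G \<subseteq> K\<^sub>m\<^sub>,\<^sub>n\<close> is its set of edges \<open>(i, j)\<close>, where \<open>i :: 'm\<close> is a left vertex and
  \<open>j :: 'n\<close> is a right vertex; \<open>m = CARD('m)\<close> and \<open>n = CARD('n)\<close> are arbitrary positive numbers.
  The mirror image \<open>G\<^sup>*\<close> is the converse relation \<open>G\<inverse>\<close>.
\<close>

definition no_isolated_vertices :: "('m \<times> 'n) set \<Rightarrow> bool" where
  "no_isolated_vertices G \<longleftrightarrow> (\<forall>i. \<exists>j. (i, j) \<in> G) \<and> (\<forall>j. \<exists>i. (i, j) \<in> G)"

definition nbrs :: "('m \<times> 'n) set \<Rightarrow> 'm \<Rightarrow> 'n set" where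
  "nbrs G i = {j. (i, j) \<in> G}"

definition coord_simplex :: "'n::finite set \<Rightarrow> (real ^ 'n) set" where
  "coord_simplex I = convex hull ((\<lambda>i. axis i 1) ` I)"

text \<open>The sum below is a sum of sets in the sense of \<open>Set_Algebras\<close>, i.e. the Minkowski sum.\<close>

definition gen_permutohedron :: "('m::finite \<times> 'n::finite) set \<Rightarrow> (real ^ 'n) set" where
  "gen_permutohedron G = (\<Sum>i\<in>UNIV. coord_simplex (nbrs G i))"

definition trimmed_gen_permutohedron :: "('m::finite \<times> 'n::finite) set \<Rightarrow> (real ^ 'n) set" where
  "trimmed_gen_permutohedron G = {x. (\<lambda>y. x + y) ` coord_simplex UNIV \<subseteq> gen_permutohedron G}"

definition lattice_points :: "(real ^ 'n::finite) set \<Rightarrow> (real ^ 'n) set" where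
  "lattice_points P = {x \<in> P. \<forall>j. x $ j \<in> \<int>}"

text \<open>Bounded sets have finitely many lattice points, so \<open>card\<close> really counts them.\<close>

lemma finite_lattice_points:
  assumes "bounded P"
  shows "finite (lattice_points P)"
proof -
  obtain B where B: "\<And>x. x \<in> P \<Longrightarrow> norm x \<le> B"
    using assms by (auto simp: bounded_iff)
  have fin: "finite {z :: real. z \<in> \<int> \<and> \<bar>z\<bar> \<le> B}"
    by (rule finite_abs_int_segment)
  have "lattice_points P \<subseteq> vec_lambda ` (UNIV \<rightarrow>\<^sub>E {z. z \<in> \<int> \<and> \<bar>z\<bar> \<le> B})"
  proof
    fix x assume x: "x \<in> lattice_points P"
    have "\<bar>x $ j\<bar> \<le> B" for j
      using component_le_norm_cart[of x j] B[of x] x by (auto simp: lattice_points_def)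
    with x show "x \<in> vec_lambda ` (UNIV \<rightarrow>\<^sub>E {z. z \<in> \<int> \<and> \<bar>z\<bar> \<le> B})"
      by (intro image_eqI[of _ _ "vec_nth x"]) (auto simp: lattice_points_def)
  qed
  with fin show ?thesis
    by (meson finite_PiE finite_class.finite_UNIV finite_imageI finite_subset)
qed

lemma bounded_gen_permutohedron:
  fixes G :: "('m::finite \<times> 'n::finite) set"
  shows "bounded (gen_permutohedron G)"
proof -
  have bc: "bounded (coord_simplex I)" for I :: "'n set"
    unfolding coord_simplex_def by (intro bounded_convex_hull finite_imp_bounded) simp
  have "bounded (\<Sum>i\<in>A. coord_simplex (nbrs G i))" if "finite A" for A
    using that
  proof induction
    case empty
    then show ?case by (simp add: set_zero)
  next
    case (insert a A)
    have "bounded (coord_simplex (nbrs G a) + (\<Sum>i\<in>A. coord_simplex (nbrs G i)))"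
      using bounded_sums[OF bc insert.IH]
      by (rule bounded_subset) (auto simp: set_plus_def)
    then show ?case
      using insert.hyps by simp
  qed
  then show ?thesis by (simp add: gen_permutohedron_def)
qed

lemma finite_lattice_points_trimmed:
  fixes G :: "('m::finite \<times> 'n::finite) set"
  shows "finite (lattice_points (trimmed_gen_permutohedron G))"
proof -
  obtain B where B: "\<And>x. x \<in> gen_permutohedron G \<Longrightarrow> norm x \<le> B"
    using bounded_gen_permutohedron[of G] by (auto simp: bounded_iff)
  let ?e = "axis undefined 1 :: real ^ 'n"
  have e: "?e \<in> coord_simplex UNIV"
    unfolding coord_simplex_def by (rule hull_inc) simp
  have "norm x \<le> B + norm ?e" if "x \<in> trimmed_gen_permutohedron G" for x
  proof -
    have "x + ?e \<in> gen_permutohedron G"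
      using that e by (auto simp: trimmed_gen_permutohedron_def)
    then have "norm (x + ?e) \<le> B" by (rule B)
    with norm_triangle_ineq4[of "x + ?e" ?e] show ?thesis by simp
  qed
  then have "bounded (trimmed_gen_permutohedron G)"
    unfolding bounded_iff by blast
  then show ?thesis by (rule finite_lattice_points)
qed

end

theory Submission
  imports Defs
begin

text \<open>
  A lattice point \<open>x\<close> lies in the trimmed generalized permutohedron iff \<open>\<Sum>x = m - 1\<close> and
  \<open>\<Sum>\<^sub>j\<^sub>\<in>\<^sub>J x\<^sub>j < |N(J)|\<close> for all nonempty \<open>J\<close>; call such vectors hypertrees. Adding an edge
  \<open>(i, j)\<close> to a graph creates new hypertrees, and each of them has a greatest set \<open>Q \<ni> j\<close> that violated
  the inequality before. It cuts the vertices into two parts joined from left to right only by \<open>(i, j)\<close>,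
  and the hypertree splits uniquely into hypertrees of the two parts. The resulting recursion for the
  number of hypertrees is invariant under exchanging left and right.
\<close>

section \<open>Hypertrees, cuts and gluing: definitions and basic bounds\<close>

definition left_nbrs :: "'a set \<Rightarrow> ('a \<times> 'b) set \<Rightarrow> 'b set \<Rightarrow> 'a set" where
  "left_nbrs L E J = {a \<in> L. \<exists>b\<in>J. (a, b) \<in> E}"

text \<open>Values are integers without a sign condition because parts of a cut may have isolated
  vertices: for \<open>L = {}\<close> and \<open>R = {b}\<close> the only hypertree has value -1 at
  \<open>b\<close>. Vanishing outside \<open>R\<close> lets a vector be identified with its
  restriction to \<open>R\<close>, so that counting makes sense.\<close>

definition hypertrees :: "'a set \<Rightarrow> 'b set \<Rightarrow> ('a \<times> 'b) set \<Rightarrow> ('b \<Rightarrow> int) set" where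
  "hypertrees L R E = {x. (\<forall>b. b \<notin> R \<longrightarrow> x b = 0) \<and> sum x R = int (card L) - 1 \<and>
     (\<forall>J. J \<subseteq> R \<and> J \<noteq> {} \<longrightarrow> sum x J < int (card (left_nbrs L E J)))}"

text \<open>The two parts are \<open>(L - P, R - Q)\<close>, which contains \<open>i\<close>, and
  \<open>(P, Q)\<close>, which contains \<open>j\<close>. Only edges from \<open>L - P\<close> to
  \<open>Q\<close> are excluded; edges from \<open>P\<close> to \<open>R - Q\<close> may
  exist.\<close>

definition cuts :: "'a set \<Rightarrow> 'b set \<Rightarrow> ('a \<times> 'b) set \<Rightarrow> 'a \<Rightarrow> 'b \<Rightarrow> ('a set \<times> 'b set) set" where
  "cuts L R E i j = {(P, Q). P \<subseteq> L - {i} \<and> Q \<subseteq> R \<and> j \<in> Q \<and> E \<inter> (L - P) \<times> Q = {}}"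

text \<open>The extra 1 at \<open>j\<close> accounts for the new edge: it restores the total, since
  \<open>(card (L - P) - 1) + (card P - 1) + 1 = card L - 1\<close>.\<close>

definition glue :: "'b \<Rightarrow> ('b \<Rightarrow> int) \<times> ('b \<Rightarrow> int) \<Rightarrow> 'b \<Rightarrow> int" where
  "glue j = (\<lambda>(y, z) b. y b + z b + of_bool (b = j))"

lemma left_nbrs_Un: "left_nbrs L E (J \<union> K) = left_nbrs L E J \<union> left_nbrs L E K"
  by (auto simp: left_nbrs_def)

lemma left_nbrs_subset: "left_nbrs L E J \<subseteq> L"
  by (auto simp: left_nbrs_def)

lemma finite_left_nbrs [simp]: "finite L \<Longrightarrow> finite (left_nbrs L E J)"
  by (auto simp: left_nbrs_def)

lemma left_nbrs_insert:
  "i \<in> L \<Longrightarrow> left_nbrs L (insert (i, j) E) J = left_nbrs L E J \<union> (if j \<in> J then {i} else {})"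
  by (auto simp: left_nbrs_def)

lemma card_left_nbrs_le: "finite L \<Longrightarrow> int (card (left_nbrs L E J)) \<le> int (card L)"
  by (simp add: card_mono left_nbrs_subset)

lemma hypertreesD:
  assumes "x \<in> hypertrees L R E"
  shows "b \<notin> R \<Longrightarrow> x b = 0" "sum x R = int (card L) - 1"
    "J \<subseteq> R \<Longrightarrow> J \<noteq> {} \<Longrightarrow> sum x J < int (card (left_nbrs L E J))"
  using assms by (auto simp: hypertrees_def)

lemma hypertrees_mono:
  assumes "finite L" "E \<subseteq> F"
  shows "hypertrees L R E \<subseteq> hypertrees L R F"
proof
  fix x assume x: "x \<in> hypertrees L R E"
  have "sum x J < int (card (left_nbrs L F J))" if "J \<subseteq> R" "J \<noteq> {}" for J
  proof -
    have "card (left_nbrs L E J) \<le> card (left_nbrs L F J)"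
      using assms by (intro card_mono) (auto simp: left_nbrs_def)
    then show ?thesis
      using hypertreesD(3)[OF x that] by linarith
  qed
  then show "x \<in> hypertrees L R F"
    using hypertreesD(1,2)[OF x] by (simp add: hypertrees_def)
qed

lemma hypertrees_insert_irrelevant:
  assumes "(i, j) \<notin> L \<times> R"
  shows "hypertrees L R (insert (i, j) E) = hypertrees L R E"
proof -
  have "left_nbrs L (insert (i, j) E) J = left_nbrs L E J" if "J \<subseteq> R" for J
    using assms that by (auto simp: left_nbrs_def)
  then show ?thesis
    by (auto simp: hypertrees_def)
qed

text \<open>Every partial sum is at most \<open>card L\<close>. Applied to \<open>R - {b}\<close>,
  this and the fixed total \<open>card L - 1\<close> also bound \<open>x b\<close> from below by
  -1.\<close>

lemma finite_hypertrees:
  fixes L :: "'a set" and R :: "'b set"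
  assumes "finite L" "finite R"
  shows "finite (hypertrees L R E)"
proof -
  let ?m = "int (card L)"
  have le: "sum x J \<le> ?m" if "x \<in> hypertrees L R E" "J \<subseteq> R" for x J
    using hypertreesD(3)[OF that] card_left_nbrs_le[OF assms(1), of E J] by (cases "J = {}") auto
  have "x b \<in> {-1..?m}" if x: "x \<in> hypertrees L R E" and b: "b \<in> R" for x b
  proof -
    have "sum x {b} \<le> ?m" "sum x (R - {b}) \<le> ?m"
      using b le[OF x, of "{b}"] le[OF x, of "R - {b}"] by blast+
    moreover have "sum x R = x b + sum x (R - {b})"
      using assms(2) b by (rule sum.remove)
    ultimately show ?thesis
      using hypertreesD(2)[OF x] by simp
  qed
  then have "hypertrees L R E \<subseteq> {x. \<forall>b. (b \<in> R \<longrightarrow> x b \<in> {-1..?m}) \<and> (b \<notin> R \<longrightarrow> x b = 0)}"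
    by (intro subsetI CollectI allI conjI impI hypertreesD(1)[where L = L and R = R and E = E])
  then show ?thesis
    by (rule finite_subset) (intro finite_set_of_finite_funs assms; simp)
qed

lemma sum_glue:
  assumes "finite R" "J \<subseteq> R" "Q \<subseteq> R" "j \<in> Q"
    and "\<And>b. b \<notin> R - Q \<Longrightarrow> y b = 0" "\<And>b. b \<notin> Q \<Longrightarrow> z b = 0"
  shows "sum (glue j (y, z)) J = sum y (J - Q) + sum z (J \<inter> Q) + of_bool (j \<in> J)"
proof -
  have fin: "finite J"
    using assms(1,2) by (rule rev_finite_subset)
  have "sum (glue j (y, z)) J = sum y J + sum z J + (\<Sum>b\<in>J. of_bool (b = j))"
    by (simp add: glue_def sum.distrib)
  moreover have "sum y J = sum y (J - Q)" "sum z J = sum z (J \<inter> Q)"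
    using assms fin by (auto intro!: sum.mono_neutral_right)
  moreover have "(\<Sum>b\<in>J. of_bool (b = j) :: int) = of_bool (j \<in> J)"
    using fin by (simp add: of_bool_def)
  ultimately show ?thesis by simp
qed

text \<open>The inequality for \<open>J = R\<close> leaves no room for a left vertex without
  neighbours in \<open>R\<close>.\<close>

lemma hypertrees_left_nbrs:
  assumes "finite L" "x \<in> hypertrees L R E" "R \<noteq> {}"
  shows "left_nbrs L E R = L"
proof -
  have "card L \<le> card (left_nbrs L E R)"
    using hypertreesD(2,3)[OF assms(2)] assms(3) by force
  then show ?thesis
    using assms(1) left_nbrs_subset by (metis card_seteq)
qed

lemma left_nbrs_cut:
  assumes "(P, Q) \<in> cuts L R E i j" "J \<subseteq> R"
  shows "left_nbrs L E J \<supseteq> left_nbrs (L - P) E (J - Q) \<union> left_nbrs P E (J \<inter> Q)"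
  using assms by (auto simp: cuts_def left_nbrs_def)

text \<open>The two neighbourhoods on the left lie in the disjoint sets \<open>L - P\<close> and
  \<open>P\<close>. Equality can fail because edges from \<open>P\<close> to \<open>J - Q\<close>
  count only on the right.\<close>

lemma card_left_nbrs_cut:
  assumes "finite L" "(P, Q) \<in> cuts L R E i j" "J \<subseteq> R"
  shows "card (left_nbrs (L - P) E (J - Q)) + card (left_nbrs P E (J \<inter> Q)) \<le> card (left_nbrs L E J)"
proof -
  have "finite P"
    using assms by (auto simp: cuts_def intro: finite_subset)
  then have "card (left_nbrs (L - P) E (J - Q)) + card (left_nbrs P E (J \<inter> Q))
      = card (left_nbrs (L - P) E (J - Q) \<union> left_nbrs P E (J \<inter> Q))"
    using assms(1) by (intro card_Un_disjoint[symmetric]) (auto simp: left_nbrs_def)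
  also have "\<dots> \<le> card (left_nbrs L E J)"
    using assms(1) left_nbrs_cut[OF assms(2,3)] by (intro card_mono) auto
  finally show ?thesis .
qed

section \<open>Adding one edge: the recursion for the number of hypertrees\<close>

context
  fixes L :: "'a set" and R :: "'b set" and E :: "('a \<times> 'b) set" and i :: 'a and j :: 'b
  assumes fin: "finite L" "finite R" and ij: "i \<in> L" "j \<in> R"
begin

text \<open>Besides membership, the conclusions recover the cut from the glued vector:
  \<open>Q\<close> attains the bound for \<open>E\<close>, no proper superset of \<open>Q\<close>
  does, and \<open>P\<close> is the neighbourhood of \<open>Q\<close>. This later yields
  disjointness of the images of different cuts.\<close>

lemma glue_hypertree:
  assumes "(P, Q) \<in> cuts L R E i j" "y \<in> hypertrees (L - P) (R - Q) E" "z \<in> hypertrees P Q E"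
  shows "glue j (y, z) \<in> hypertrees L R (insert (i, j) E)"
    "sum (glue j (y, z)) Q = int (card (left_nbrs L E Q))"
    "left_nbrs L E Q = P"
    "\<And>J. J \<subseteq> R \<Longrightarrow> Q \<subset> J \<Longrightarrow> sum (glue j (y, z)) J < int (card (left_nbrs L E J))"
proof -
  have PQ: "P \<subseteq> L" "i \<notin> P" "Q \<subseteq> R" "j \<in> Q" "E \<inter> (L - P) \<times> Q = {}"
    using assms(1) by (auto simp: cuts_def)
  have finP: "finite P"
    using PQ(1) fin(1) by (rule finite_subset)
  have sum: "sum (glue j (y, z)) J = sum y (J - Q) + sum z (J \<inter> Q) + of_bool (j \<in> J)"
    if "J \<subseteq> R" for J
    using fin(2) that PQ(3,4) hypertreesD(1)[OF assms(2)] hypertreesD(1)[OF assms(3)]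
    by (rule sum_glue)
  have P: "left_nbrs P E Q = P"
    using hypertrees_left_nbrs[OF finP assms(3)] PQ(4) by auto
  show N: "left_nbrs L E Q = P"
    using PQ P by (auto simp: left_nbrs_def)
  have z: "sum z Q = int (card P) - 1"
    by (rule hypertreesD(2)[OF assms(3)])
  show tight: "sum (glue j (y, z)) Q = int (card (left_nbrs L E Q))"
    using sum[of Q] PQ N z by simp
  show "sum (glue j (y, z)) J < int (card (left_nbrs L E J))" if J: "J \<subseteq> R" "Q \<subset> J" for J
  proof -
    have "sum y (J - Q) < int (card (left_nbrs (L - P) E (J - Q)))"
      using J by (intro hypertreesD(3)[OF assms(2)]) auto
    moreover have "J \<inter> Q = Q" "j \<in> J"
      using J PQ by auto
    ultimately show ?thesis
      using card_left_nbrs_cut[OF fin(1) assms(1) J(1)] sum[OF J(1)] z P by simp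
  qed
  show "glue j (y, z) \<in> hypertrees L R (insert (i, j) E)"
    unfolding hypertrees_def mem_Collect_eq
  proof (intro conjI allI impI)
    show "glue j (y, z) b = 0" if "b \<notin> R" for b
      using that PQ hypertreesD(1)[OF assms(2), of b] hypertreesD(1)[OF assms(3), of b]
      by (auto simp: glue_def)
    have "int (card (L - P)) = int (card L) - int (card P)"
      using PQ(1) finP fin(1) by (simp add: card_Diff_subset card_mono of_nat_diff)
    moreover have "R \<inter> Q = Q"
      using PQ by auto
    ultimately show "sum (glue j (y, z)) R = int (card L) - 1"
      using sum[of R] z hypertreesD(2)[OF assms(2)] ij by simp
    fix J assume J: "J \<subseteq> R \<and> J \<noteq> {}"
    note le = card_left_nbrs_cut[OF fin(1) assms(1) conjunct1[OF J]]
    have y: "sum y (J - Q) < int (card (left_nbrs (L - P) E (J - Q)))" if "J - Q \<noteq> {}"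
      using that J by (intro hypertreesD(3)[OF assms(2)]) auto
    have z: "sum z (J \<inter> Q) < int (card (left_nbrs P E (J \<inter> Q)))" if "J \<inter> Q \<noteq> {}"
      using that J by (intro hypertreesD(3)[OF assms(3)]) auto
    show "sum (glue j (y, z)) J < int (card (left_nbrs L (insert (i, j) E) J))"
    \<comment> \<open>If \<open>J\<close> lies in \<open>Q\<close> and contains \<open>j\<close>,
      the extra 1 at \<open>j\<close> is paid for by the new neighbour \<open>i\<close>, since all
      old neighbours of \<open>J\<close> are in \<open>P\<close>.\<close>
    proof (cases "J - Q = {} \<and> j \<in> J")
      case True
      then have "i \<notin> left_nbrs L E J"
        using PQ by (auto simp: left_nbrs_def)
      then have "card (left_nbrs L (insert (i, j) E) J) = Suc (card (left_nbrs L E J))"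
        using True ij fin by (simp add: left_nbrs_insert)
      moreover have "J \<inter> Q \<noteq> {}"
        using True PQ by auto
      ultimately show ?thesis
        using sum[of J] z J le True by simp
    next
      case False
      have "card (left_nbrs L E J) \<le> card (left_nbrs L (insert (i, j) E) J)"
        using fin by (intro card_mono) (auto simp: left_nbrs_def)
      moreover have "sum y (J - Q) + of_bool (J - Q \<noteq> {}) \<le> int (card (left_nbrs (L - P) E (J - Q)))"
      proof (cases "J - Q = {}")
        case True
        show ?thesis
          unfolding True by simp
      qed (use y in simp)
      moreover have "sum z (J \<inter> Q) + of_bool (J \<inter> Q \<noteq> {}) \<le> int (card (left_nbrs P E (J \<inter> Q)))"
        using z by (cases "J \<inter> Q = {}") simp_all
      \<comment> \<open>Each nonempty piece of \<open>J\<close> gives one unit of slack by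
        strictness. If \<open>j \<in> J\<close>, both pieces are nonempty in this case, which covers
        the extra 1 and still leaves one unit.\<close>
      moreover have "of_bool (j \<in> J) + 1 \<le> (of_bool (J - Q \<noteq> {}) + of_bool (J \<inter> Q \<noteq> {}) :: int)"
        using False J PQ(4) by (cases "j \<in> J") (auto simp: of_bool_def)
      ultimately show ?thesis
        using sum[OF conjunct1[OF J]] le by linarith
    qed
  qed
qed

text \<open>Sets through \<open>j\<close> that attain the bound for \<open>E\<close> are closed
  under union, by submodularity of the neighbourhood size. Restricting \<open>x\<close> to the
  greatest such set and to its complement gives the two parts.\<close>

lemma new_hypertree_split:
  assumes x: "x \<in> hypertrees L R (insert (i, j) E)" "x \<notin> hypertrees L R E"
  shows "\<exists>P Q y z. (P, Q) \<in> cuts L R E i j \<and> y \<in> hypertrees (L - P) (R - Q) E \<and>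
    z \<in> hypertrees P Q E \<and> x = glue j (y, z)"
proof -
  let ?N = "left_nbrs L E"
  let ?N' = "left_nbrs L (insert (i, j) E)"
  have N': "?N' J = ?N J \<union> (if j \<in> J then {i} else {})" for J
    using ij(1) by (rule left_nbrs_insert)
  have bound: "sum x J < int (card (?N' J))" if "J \<subseteq> R" "J \<noteq> {}" for J
    using hypertreesD(3)[OF x(1) that] .
  \<comment> \<open>The new edge adds at most one neighbour, so the old bound can fail only by
    turning into an equality.\<close>
  have le: "sum x J \<le> int (card (?N J))" if "J \<subseteq> R" for J
    using bound[of J] that fin(1) by (cases "J = {}") (auto simp: N' card_insert_if split: if_splits)
  define T where "T = {J. J \<subseteq> R \<and> j \<in> J \<and> sum x J = int (card (?N J))}"
  have "T \<noteq> {}"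
  proof -
    obtain J where J: "J \<subseteq> R" "J \<noteq> {}" "\<not> sum x J < int (card (?N J))"
      using x hypertreesD(1,2)[OF x(1)] unfolding hypertrees_def by blast
    moreover have "j \<in> J"
      using bound[OF J(1,2)] J(3) by (auto simp: N' split: if_splits)
    ultimately show ?thesis
      using le[of J] by (auto simp: T_def)
  qed
  \<comment> \<open>The sum is modular and the neighbourhood size submodular, so equality at
    \<open>J\<close> and \<open>K\<close> forces equality at \<open>J \<union> K\<close>.\<close>
  moreover have Un: "J \<union> K \<in> T" if "J \<in> T" "K \<in> T" for J K
  proof -
    have JK: "J \<subseteq> R" "K \<subseteq> R" "finite J" "finite K"
      using that fin(2) by (auto simp: T_def intro: finite_subset)
    have "sum x (J \<union> K) + sum x (J \<inter> K) = sum x J + sum x K"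
      using JK by (simp add: sum.union_inter)
    moreover have "card (?N (J \<union> K)) + card (?N J \<inter> ?N K) = card (?N J) + card (?N K)"
      using card_Un_Int[of "?N J" "?N K"] fin(1) by (simp add: left_nbrs_Un)
    moreover have "card (?N (J \<inter> K)) \<le> card (?N J \<inter> ?N K)"
      using fin(1) by (intro card_mono) (auto simp: left_nbrs_def)
    moreover have "sum x (J \<inter> K) \<le> int (card (?N (J \<inter> K)))" "sum x (J \<union> K) \<le> int (card (?N (J \<union> K)))"
      using JK le[of "J \<inter> K"] le[of "J \<union> K"] by blast+
    moreover have "sum x J = int (card (?N J))" "sum x K = int (card (?N K))"
      using that by (simp_all add: T_def)
    ultimately have "sum x (J \<union> K) = int (card (?N (J \<union> K)))"
      by linarith
    then show ?thesis
      using that by (auto simp: T_def)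
  qed
  moreover have "finite T"
    using fin(2) by (auto simp: T_def)
  ultimately have "\<Union>T \<in> T"
    using finite_Sup_in by (metis Sup_set_def Un)
  define Q where "Q = \<Union>T"
  define P where "P = ?N Q"
  have Q: "Q \<subseteq> R" "j \<in> Q" "sum x Q = int (card P)"
    using \<open>\<Union>T \<in> T\<close> by (auto simp: Q_def P_def T_def)
  have max: "J \<subseteq> Q" if "J \<in> T" for J
    using that by (auto simp: Q_def)
  have "Q \<noteq> {}"
    using Q by auto
  \<comment> \<open>Otherwise the new edge would not enlarge the neighbourhood of \<open>Q\<close>,
    and equality at \<open>Q\<close> would violate the strict bound.\<close>
  have "i \<notin> P"
    using bound[OF Q(1) \<open>Q \<noteq> {}\<close>] Q by (auto simp: N' P_def insert_absorb)
  have P: "P \<subseteq> L" "finite P"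
    using fin(1) by (auto simp: P_def left_nbrs_def)
  have cut: "(P, Q) \<in> cuts L R E i j"
    using Q P \<open>i \<notin> P\<close> by (auto simp: cuts_def P_def left_nbrs_def)
  define y where "y = (\<lambda>b. if b \<in> Q then 0 else x b)"
  define z where "z = (\<lambda>b. if b \<in> Q then x b - of_bool (b = j) else 0)"
  have "x = glue j (y, z)"
    using Q(2) by (auto simp: glue_def y_def z_def)
  moreover have "y \<in> hypertrees (L - P) (R - Q) E"
    unfolding hypertrees_def mem_Collect_eq
  proof (intro conjI allI impI)
    show "y b = 0" if "b \<notin> R - Q" for b
      using that hypertreesD(1)[OF x(1)] by (auto simp: y_def)
    have y: "sum y J = sum x J" if "J \<subseteq> R - Q" for J
      using that by (intro sum.cong) (auto simp: y_def)
    have "int (card (L - P)) = int (card L) - int (card P)"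
      using P fin(1) by (simp add: card_Diff_subset card_mono of_nat_diff)
    then show "sum y (R - Q) = int (card (L - P)) - 1"
      using y[of "R - Q"] sum.subset_diff[OF Q(1) fin(2), of x] Q(3) hypertreesD(2)[OF x(1)]
      by simp
    \<comment> \<open>Maximality of \<open>Q\<close> makes the bound at \<open>J \<union> Q\<close>
      strict; subtracting the equality at \<open>Q\<close> leaves a strict bound for
      \<open>J\<close> in the part \<open>L - P\<close>.\<close>
    fix J assume J: "J \<subseteq> R - Q \<and> J \<noteq> {}"
    then have "J \<union> Q \<notin> T"
      using max[of "J \<union> Q"] by auto
    then have "sum x (J \<union> Q) < int (card (?N (J \<union> Q)))"
    proof -
      have "J \<union> Q \<subseteq> R"
        using J Q(1) by blast
      then show ?thesis
        using le[of "J \<union> Q"] \<open>J \<union> Q \<notin> T\<close> Q(2) by (auto simp: T_def)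
    qed
    moreover have "sum x (J \<union> Q) = sum x J + sum x Q"
      using J Q fin(2) by (intro sum.union_disjoint) (auto intro: finite_subset)
    moreover have "?N (J \<union> Q) = left_nbrs (L - P) E J \<union> P"
      by (auto simp: P_def left_nbrs_def)
    moreover have "card (left_nbrs (L - P) E J \<union> P) = card (left_nbrs (L - P) E J) + card P"
      using P fin(1) by (intro card_Un_disjoint) (auto simp: left_nbrs_def)
    ultimately show "sum y J < int (card (left_nbrs (L - P) E J))"
      using Q y[of J] J by auto
  qed
  moreover have "z \<in> hypertrees P Q E"
    unfolding hypertrees_def mem_Collect_eq
  proof (intro conjI allI impI)
    show "z b = 0" if "b \<notin> Q" for b
      using that by (auto simp: z_def)
    have z: "sum z J = sum x J - of_bool (j \<in> J)" if "J \<subseteq> Q" for J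
    proof -
      have "finite J"
        using that Q fin(2) by (meson finite_subset)
      moreover have "sum z J = (\<Sum>b\<in>J. x b - of_bool (b = j))"
        using that by (intro sum.cong) (auto simp: z_def)
      ultimately show ?thesis
        by (simp add: sum_subtractf of_bool_def)
    qed
    then show "sum z Q = int (card P) - 1"
      using Q by auto
    \<comment> \<open>If \<open>j \<in> J\<close>, the new edge adds exactly the neighbour
      \<open>i\<close>, which cancels against the 1 removed at \<open>j\<close>.\<close>
    fix J assume J: "J \<subseteq> Q \<and> J \<noteq> {}"
    have "left_nbrs P E J = ?N J" "i \<notin> ?N J"
      using J \<open>i \<notin> P\<close> by (auto simp: P_def left_nbrs_def)
    then show "sum z J < int (card (left_nbrs P E J))"
    proof -
      have "J \<subseteq> R"
        using J Q(1) by blast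
      then show ?thesis
        using z[of J] bound[of J] \<open>left_nbrs P E J = ?N J\<close> \<open>i \<notin> ?N J\<close> J fin(1)
        by (auto simp: N' split: if_splits)
    qed
  qed
  ultimately show ?thesis
    using cut by blast
qed

lemma hypertrees_insert:
  "hypertrees L R (insert (i, j) E) = hypertrees L R E \<union>
     (\<Union>(P, Q)\<in>cuts L R E i j. glue j ` (hypertrees (L - P) (R - Q) E \<times> hypertrees P Q E))"
  (is "_ = _ \<union> ?U")
proof (intro equalityI subsetI)
  fix x assume "x \<in> hypertrees L R (insert (i, j) E)"
  then show "x \<in> hypertrees L R E \<union> ?U"
    using new_hypertree_split[of x] by (cases "x \<in> hypertrees L R E") fastforce+
next
  fix x assume "x \<in> hypertrees L R E \<union> ?U"
  then show "x \<in> hypertrees L R (insert (i, j) E)"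
    using hypertrees_mono[OF fin(1), of E "insert (i, j) E" R] glue_hypertree(1)
    by auto
qed

text \<open>The union in \<open>hypertrees_insert\<close> is disjoint and each \<open>glue j\<close>
  is injective on its domain, so cardinalities add and multiply.\<close>

lemma card_hypertrees_insert:
  "card (hypertrees L R (insert (i, j) E)) = card (hypertrees L R E) +
     (\<Sum>(P, Q)\<in>cuts L R E i j. card (hypertrees (L - P) (R - Q) E) * card (hypertrees P Q E))"
proof -
  let ?F = "\<lambda>(P, Q). glue j ` (hypertrees (L - P) (R - Q) E \<times> hypertrees P Q E)"
  have fincuts: "finite (cuts L R E i j)"
    by (rule finite_subset[of _ "Pow L \<times> Pow R"]) (use fin in \<open>auto simp: cuts_def\<close>)
  have finF: "finite (?F c)" if "c \<in> cuts L R E i j" for c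
  proof -
    obtain P Q where c: "c = (P, Q)"
      by (cases c)
    then have "finite P" "finite Q"
      using that fin by (auto simp: cuts_def intro: finite_subset)
    then show ?thesis
      using fin by (simp add: c finite_hypertrees)
  qed
  \<comment> \<open>A common vector would attain the bound at \<open>Q\<close> and
    \<open>Q'\<close>, hence by submodularity at their union. As neither set has a proper superset
    attaining it, both equal the union.\<close>
  have disj: "?F c \<inter> ?F d = {}" if cd: "c \<in> cuts L R E i j" "d \<in> cuts L R E i j" "c \<noteq> d" for c d
  proof (rule ccontr)
    obtain P Q P' Q' where [simp]: "c = (P, Q)" "d = (P', Q')"
      by (cases c, cases d)
    assume "?F c \<inter> ?F d \<noteq> {}"
    then obtain y z y' z' where
      yz: "y \<in> hypertrees (L - P) (R - Q) E" "z \<in> hypertrees P Q E" and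
      yz': "y' \<in> hypertrees (L - P') (R - Q') E" "z' \<in> hypertrees P' Q' E" and
      eq: "glue j (y, z) = glue j (y', z')"
      by auto
    have PQ: "(P, Q) \<in> cuts L R E i j" "(P', Q') \<in> cuts L R E i j"
      using cd by auto
    note g = glue_hypertree[OF PQ(1) yz] and g' = glue_hypertree[OF PQ(2) yz']
    let ?x = "glue j (y, z)"
    have sub: "Q \<subseteq> R" "Q' \<subseteq> R" "j \<in> Q" "j \<in> Q'"
      using PQ by (auto simp: cuts_def)
    have le: "sum ?x J \<le> int (card (left_nbrs L E J))" if "J \<subseteq> R" "J \<noteq> {}" for J
      using hypertreesD(3)[OF g(1) that] fin ij
      by (auto simp: left_nbrs_insert card_insert_if split: if_splits)
    have "sum ?x (Q \<union> Q') + sum ?x (Q \<inter> Q') = sum ?x Q + sum ?x Q'"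
      using sub fin(2) by (intro sum.union_inter) (auto intro: finite_subset)
    moreover have "card (left_nbrs L E (Q \<union> Q')) + card (left_nbrs L E Q \<inter> left_nbrs L E Q')
        = card (left_nbrs L E Q) + card (left_nbrs L E Q')"
      using card_Un_Int[of "left_nbrs L E Q" "left_nbrs L E Q'"] fin(1) by (simp add: left_nbrs_Un)
    moreover have "card (left_nbrs L E (Q \<inter> Q')) \<le> card (left_nbrs L E Q \<inter> left_nbrs L E Q')"
      using fin(1) by (intro card_mono) (auto simp: left_nbrs_def)
    moreover have "sum ?x (Q \<inter> Q') \<le> int (card (left_nbrs L E (Q \<inter> Q')))"
      using sub by (intro le) auto
    ultimately have "\<not> sum ?x (Q \<union> Q') < int (card (left_nbrs L E (Q \<union> Q')))"
      using g(2) g'(2) eq by simp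
    then have "\<not> Q \<subset> Q \<union> Q'" "\<not> Q' \<subset> Q \<union> Q'"
      using g(4)[of "Q \<union> Q'"] g'(4)[of "Q \<union> Q'"] sub eq by auto
    then have "Q = Q'"
      by blast
    then show False
      using g(3) g'(3) cd(3) by simp
  qed
  have cardF: "card (?F c) = (case c of (P, Q) \<Rightarrow> card (hypertrees (L - P) (R - Q) E) * card (hypertrees P Q E))"
    if "c \<in> cuts L R E i j" for c
  proof -
    obtain P Q where c: "c = (P, Q)"
      by (cases c)
    have "inj_on (glue j) (hypertrees (L - P) (R - Q) E \<times> hypertrees P Q E)"
    proof (rule inj_onI; clarify)
      fix y z y' z'
      assume yz: "y \<in> hypertrees (L - P) (R - Q) E" "z \<in> hypertrees P Q E"
        "y' \<in> hypertrees (L - P) (R - Q) E" "z' \<in> hypertrees P Q E"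
        "glue j (y, z) = glue j (y', z')"
      have *: "y b + z b = y' b + z' b" for b
        using fun_cong[OF yz(5), of b] by (simp add: glue_def)
      \<comment> \<open>The supports are separated by \<open>Q\<close>, so one summand on each side
        vanishes at \<open>b\<close>.\<close>
      have "y b = y' b \<and> z b = z' b" for b
        using *[of b] yz(1-4)[THEN hypertreesD(1), of b] by (cases "b \<in> Q") auto
      then show "y = y' \<and> z = z'"
        by auto
    qed
    then show ?thesis
      by (simp add: c card_image card_cartesian_product)
  qed
  \<comment> \<open>A glued vector attains the bound at \<open>Q\<close>, where a hypertree of
    \<open>E\<close> has to stay strictly below it.\<close>
  have old: "hypertrees L R E \<inter> (\<Union>c\<in>cuts L R E i j. ?F c) = {}"
  proof -
    have "glue j (y, z) \<notin> hypertrees L R E"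
      if "(P, Q) \<in> cuts L R E i j" "y \<in> hypertrees (L - P) (R - Q) E" "z \<in> hypertrees P Q E" for P Q y z
      using hypertreesD(3)[of "glue j (y, z)" L R E Q] glue_hypertree(2)[OF that] that(1)
      by (auto simp: cuts_def)
    then show ?thesis
      by auto
  qed
  have "card (hypertrees L R (insert (i, j) E))
      = card (hypertrees L R E) + card (\<Union>c\<in>cuts L R E i j. ?F c)"
    unfolding hypertrees_insert
    by (intro card_Un_disjoint old finite_hypertrees fin finite_UN_I fincuts finF)
  also have "card (\<Union>c\<in>cuts L R E i j. ?F c) = (\<Sum>c\<in>cuts L R E i j. card (?F c))"
    using fincuts finF disj by (intro card_UN_disjoint) auto
  also have "\<dots> = (\<Sum>(P, Q)\<in>cuts L R E i j. card (hypertrees (L - P) (R - Q) E) * card (hypertrees P Q E))"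
    by (intro sum.cong refl cardF)
  finally show ?thesis .
qed

end

section \<open>Invariance of the count under exchanging left and right\<close>

text \<open>Every right vertex has value at most -1, so the total forces
  \<open>card L + card R \<le> 1\<close>; the empty graph is excluded because its empty sum is not
  -1.\<close>

lemma hypertrees_no_edges:
  fixes L :: "'a set" and R :: "'b set"
  assumes "finite L" "finite R"
  shows "hypertrees L R {} = (if card L + card R = 1 then {\<lambda>b. if b \<in> R then -1 else 0} else {})"
proof -
  have N: "left_nbrs L {} J = {}" for J :: "'b set"
    by (simp add: left_nbrs_def)
  have neg: "x b \<le> -1" if "x \<in> hypertrees L R {}" "b \<in> R" for x b
    using hypertreesD(3)[OF that(1), of "{b}"] that(2) by (simp add: N)
  have card: "card L + card R = 1" if x: "x \<in> hypertrees L R {}" for x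
  proof -
    have "sum x R \<le> (\<Sum>b\<in>R. -1)"
      by (intro sum_mono neg x)
    then have "card L + card R \<le> 1"
      using hypertreesD(2)[OF x] by simp
    moreover have "\<not> (L = {} \<and> R = {})"
      using hypertreesD(2)[OF x] by auto
    ultimately show ?thesis
      using assms by (cases "card L"; cases "card R") auto
  qed
  show ?thesis
  proof (cases "card L + card R = 1")
    case False
    then show ?thesis
      using card by auto
  next
    case True
    then consider "card L = 1" "R = {}" | b where "L = {}" "R = {b}"
      using assms by (auto simp: add_is_1 card_1_singleton_iff)
    then show ?thesis
    proof cases
      case 1
      then show ?thesis
        by (auto simp: hypertrees_def)
    next
      case 2
      then show ?thesis
        by (auto simp: hypertrees_def N subset_singleton_iff)
    qed
  qed
qed

text \<open>Complementing both sets and swapping them keeps the excluded block of edges, and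
  exchanges which part contains \<open>i\<close> and which contains \<open>j\<close>.\<close>

lemma cuts_converse:
  assumes "i \<in> L" "j \<in> R"
  shows "bij_betw (\<lambda>(P, Q). (R - Q, L - P)) (cuts L R E i j) (cuts R L (E\<inverse>) j i)"
  by (rule bij_betw_byWitness[where f' = "\<lambda>(P, Q). (L - Q, R - P)"])
    (use assms in \<open>auto simp: cuts_def\<close>)

text \<open>Induction on the edges; \<open>L\<close> and \<open>R\<close> stay general because the
  recursion passes to the vertex sets of both parts.\<close>

theorem card_hypertrees_converse:
  assumes "finite E" "finite L" "finite R"
  shows "card (hypertrees L R E) = card (hypertrees R L (E\<inverse>))"
  using assms
proof (induction E arbitrary: L R rule: finite_induct)
  case empty
  then show ?case
    by (simp add: hypertrees_no_edges add.commute)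
next
  case (insert e E)
  obtain i j where e: "e = (i, j)"
    by (cases e)
  have conv: "(insert (i, j) E)\<inverse> = insert (j, i) (E\<inverse>)"
    by auto
  show ?case
  proof (cases "i \<in> L \<and> j \<in> R")
    case False
    then have "(i, j) \<notin> L \<times> R" "(j, i) \<notin> R \<times> L"
      by auto
    then show ?thesis
      using insert.IH[OF insert.prems] unfolding e conv by (simp only: hypertrees_insert_irrelevant not_False_eq_True)
  next
    case True
    then have ij: "i \<in> L" "j \<in> R"
      by auto
    \<comment> \<open>The mirrored cut has the same two parts in the opposite order, so each product
      reappears with its factors swapped.\<close>
    have "(\<Sum>c\<in>cuts R L (E\<inverse>) j i. card (hypertrees (R - fst c) (L - snd c) (E\<inverse>)) * card (hypertrees (fst c) (snd c) (E\<inverse>)))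
        = (\<Sum>c\<in>cuts L R E i j. card (hypertrees (R - (R - snd c)) (L - (L - fst c)) (E\<inverse>)) * card (hypertrees (R - snd c) (L - fst c) (E\<inverse>)))"
      by (subst sum.reindex_bij_betw[OF cuts_converse[OF ij], symmetric])
        (simp add: case_prod_unfold)
    also have "\<dots> = (\<Sum>c\<in>cuts L R E i j. card (hypertrees (L - fst c) (R - snd c) E) * card (hypertrees (fst c) (snd c) E))"
    proof (rule sum.cong[OF refl])
      fix c assume "c \<in> cuts L R E i j"
      then have c: "fst c \<subseteq> L" "snd c \<subseteq> R"
        by (auto simp: cuts_def)
      then have "finite (fst c)" "finite (snd c)"
        using insert.prems by (auto intro: finite_subset)
      moreover have "R - (R - snd c) = snd c" "L - (L - fst c) = fst c"
        using c by auto
      ultimately show "card (hypertrees (R - (R - snd c)) (L - (L - fst c)) (E\<inverse>)) * card (hypertrees (R - snd c) (L - fst c) (E\<inverse>))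
        = card (hypertrees (L - fst c) (R - snd c) E) * card (hypertrees (fst c) (snd c) E)"
        using insert.IH[of "fst c" "snd c"] insert.IH[of "L - fst c" "R - snd c"] insert.prems
        by simp
    qed
    finally show ?thesis
      using insert.IH[OF insert.prems] insert.prems ij
      by (simp add: e conv card_hypertrees_insert case_prod_unfold)
  qed
qed

section \<open>Hypertrees from assignments of left vertices to neighbours\<close>

text \<open>Equivalently, \<open>x\<close> is a sum of unit vectors, one for each
  \<open>a \<in> L\<close>, taken at a neighbour of \<open>a\<close>.\<close>

definition realizable :: "('a \<times> 'b) set \<Rightarrow> 'a set \<Rightarrow> ('b \<Rightarrow> int) \<Rightarrow> bool" where
  "realizable E L x \<longleftrightarrow>
     (\<exists>\<phi>. (\<forall>a\<in>L. (a, \<phi> a) \<in> E) \<and> (\<forall>b. int (card {a \<in> L. \<phi> a = b}) = x b))"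

lemma realizable_mono: "realizable E L x \<Longrightarrow> E \<subseteq> F \<Longrightarrow> realizable F L x"
  unfolding realizable_def by blast

lemma realizable_edge: "(i, j) \<in> E \<Longrightarrow> realizable E {i} (\<lambda>b. of_bool (b = j))"
  unfolding realizable_def by (rule exI[of _ "\<lambda>_. j"]) (auto simp: Collect_conv_if)

lemma realizable_Un:
  assumes "realizable E L x" "realizable E M y" "L \<inter> M = {}" "finite L" "finite M"
  shows "realizable E (L \<union> M) (\<lambda>b. x b + y b)"
proof -
  obtain \<phi> \<psi> where \<phi>: "\<And>a. a \<in> L \<Longrightarrow> (a, \<phi> a) \<in> E" "\<And>b. int (card {a \<in> L. \<phi> a = b}) = x b"
    and \<psi>: "\<And>a. a \<in> M \<Longrightarrow> (a, \<psi> a) \<in> E" "\<And>b. int (card {a \<in> M. \<psi> a = b}) = y b"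
    using assms(1,2) unfolding realizable_def by blast
  let ?\<chi> = "\<lambda>a. if a \<in> L then \<phi> a else \<psi> a"
  have "{a \<in> L \<union> M. ?\<chi> a = b} = {a \<in> L. \<phi> a = b} \<union> {a \<in> M. \<psi> a = b}" for b
    using assms(3) by auto
  moreover have "card ({a \<in> L. \<phi> a = b} \<union> {a \<in> M. \<psi> a = b}) = card {a \<in> L. \<phi> a = b} + card {a \<in> M. \<psi> a = b}" for b
    using assms(3-5) by (intro card_Un_disjoint) auto
  ultimately have "int (card {a \<in> L \<union> M. ?\<chi> a = b}) = x b + y b" for b
    using \<phi>(2)[of b] \<psi>(2)[of b] by simp
  moreover have "\<forall>a\<in>L \<union> M. (a, ?\<chi> a) \<in> E"
    using \<phi>(1) \<psi>(1) by auto
  ultimately show ?thesis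
    unfolding realizable_def by (intro exI[of _ ?\<chi>]) auto
qed

text \<open>
  Morally a hypertree is the vector of right degrees minus one of a spanning tree; the two claims
  correspond to rooting this tree at a right or at a left vertex and sending every other left vertex
  to its parent. Both are needed for the induction.
\<close>

lemma hypertree_realizable:
  assumes "finite E" "finite L" "finite R" "x \<in> hypertrees L R E"
  shows "(\<forall>r\<in>R. realizable E L (\<lambda>b. x b + of_bool (b = r))) \<and>
    (\<forall>l\<in>L. realizable E (L - {l}) x)"
  using assms
proof (induction E arbitrary: L R x rule: finite_induct)
  case empty
  have "card L + card R = 1 \<and> x = (\<lambda>b. if b \<in> R then -1 else 0)"
    using empty by (simp add: hypertrees_no_edges split: if_splits)
  then have "L = {} \<and> (\<exists>b. R = {b}) \<and> x = (\<lambda>b. if b \<in> R then -1 else 0) \<or>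
      (\<exists>a. L = {a}) \<and> R = {} \<and> x = (\<lambda>b. 0)"
    using empty by (auto simp: add_is_1 card_1_singleton_iff)
  then show ?case
    by (auto simp: realizable_def)
next
  case (insert e E)
  obtain i j where e: "e = (i, j)"
    by (cases e)
  show ?case
  proof (cases "x \<in> hypertrees L R E")
    case True
    then show ?thesis
      using insert.IH[OF insert.prems(1,2)] realizable_mono[of E _ _ "insert e E"] by blast
  next
    case False
    have ij: "i \<in> L" "j \<in> R"
      using False insert.prems(3) hypertrees_insert_irrelevant[of i j L R E] by (auto simp: e)
    obtain P Q y z where PQ: "(P, Q) \<in> cuts L R E i j" and y: "y \<in> hypertrees (L - P) (R - Q) E"
      and z: "z \<in> hypertrees P Q E" and x: "x = glue j (y, z)"
      using new_hypertree_split[OF insert.prems(1,2) ij, of x E] insert.prems(3) False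
      by (auto simp: e)
    have sub: "P \<subseteq> L" "i \<notin> P" "Q \<subseteq> R" "j \<in> Q"
      using PQ by (auto simp: cuts_def)
    have fin: "finite P" "finite Q"
      using sub insert.prems by (auto intro: finite_subset)
    have xb: "x b = y b + z b + of_bool (b = j)" for b
      by (simp add: x glue_def)
    let ?F = "insert e E"
    have yr: "realizable ?F (L - P) (\<lambda>b. y b + of_bool (b = r))" if "r \<in> R - Q" for r
      using insert.IH[OF _ _ y] insert.prems that by (auto intro: realizable_mono)
    have yl: "realizable ?F (L - P - {l}) y" if "l \<in> L - P" for l
      using insert.IH[OF _ _ y] insert.prems that by (auto intro: realizable_mono)
    have zr: "realizable ?F P (\<lambda>b. z b + of_bool (b = r))" if "r \<in> Q" for r
      using insert.IH[OF fin z] that by (auto intro: realizable_mono)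
    have zl: "realizable ?F (P - {l}) z" if "l \<in> P" for l
      using insert.IH[OF fin z] that by (auto intro: realizable_mono)
    \<comment> \<open>Here \<open>j\<close> lies outside \<open>R - Q\<close>, so the part is rooted
      at \<open>i\<close>, and \<open>i\<close> itself is sent to \<open>j\<close> along the new
      edge.\<close>
    have yi: "realizable ?F (L - P) (\<lambda>b. y b + of_bool (b = j))"
    proof -
      have "realizable ?F (L - P - {i} \<union> {i}) (\<lambda>b. y b + of_bool (b = j))"
        using sub ij insert.prems by (intro realizable_Un yl realizable_edge) (auto simp: e)
      moreover have "L - P - {i} \<union> {i} = L - P"
        using ij sub by auto
      ultimately show ?thesis
        by simp
    qed
    \<comment> \<open>The part containing the root keeps it, and the other part is rooted at its end
      of the new edge: at \<open>i\<close> through \<open>yi\<close>, or at \<open>j\<close> through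
      \<open>zr\<close>. Either way this supplies the extra 1 at \<open>j\<close>.\<close>
    have "realizable ?F L (\<lambda>b. x b + of_bool (b = r))" if r: "r \<in> R" for r
    proof -
      have L: "(L - P) \<union> P = L"
        using sub by auto
      show ?thesis
      proof (cases "r \<in> Q")
        case True
        have "realizable ?F ((L - P) \<union> P) (\<lambda>b. (y b + of_bool (b = j)) + (z b + of_bool (b = r)))"
          using True insert.prems fin by (intro realizable_Un yi zr) auto
        then show ?thesis
          unfolding L by (simp add: xb algebra_simps)
      next
        case False
        have "realizable ?F ((L - P) \<union> P) (\<lambda>b. (y b + of_bool (b = r)) + (z b + of_bool (b = j)))"
          using False r sub insert.prems fin by (intro realizable_Un yr zr) auto
        then show ?thesis
          unfolding L by (simp add: xb algebra_simps)
      qed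
    qed
    moreover have "realizable ?F (L - {l}) x" if l: "l \<in> L" for l
    proof (cases "l \<in> P")
      case True
      have "realizable ?F ((L - P) \<union> (P - {l})) (\<lambda>b. (y b + of_bool (b = j)) + z b)"
        using True insert.prems fin by (intro realizable_Un yi zl) auto
      moreover have "(L - P) \<union> (P - {l}) = L - {l}"
        using True sub by auto
      moreover have "(\<lambda>b. (y b + of_bool (b = j)) + z b) = x"
        by (auto simp: xb)
      ultimately show ?thesis
        by simp
    next
      case False
      have "realizable ?F ((L - P - {l}) \<union> P) (\<lambda>b. y b + (z b + of_bool (b = j)))"
        using False l sub insert.prems fin by (intro realizable_Un yl zr) auto
      moreover have "(L - P - {l}) \<union> P = L - {l}"
        using False sub by auto
      moreover have "(\<lambda>b. y b + (z b + of_bool (b = j))) = x"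
        by (auto simp: xb)
      ultimately show ?thesis
        by simp
    qed
    ultimately show ?thesis
      by blast
  qed
qed

section \<open>Lattice points of the trimmed polytope are hypertrees\<close>

lemma coord_simplex_subset:
  fixes I :: "'n::finite set"
  shows "coord_simplex I \<subseteq> {p. (\<forall>j. 0 \<le> p $ j) \<and> (\<forall>j. j \<notin> I \<longrightarrow> p $ j = 0) \<and> (\<Sum>j\<in>UNIV. p $ j) = 1}"
    (is "_ \<subseteq> ?S")
  unfolding coord_simplex_def
proof (rule hull_minimal)
  show "(\<lambda>i. axis i 1) ` I \<subseteq> ?S"
    by (auto simp: axis_def)
  show "convex ?S"
    unfolding convex_def
    by (auto simp: sum.distrib simp flip: sum_distrib_left)
qed

lemma sum_coord_simplex_le:
  fixes I :: "'n::finite set"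
  assumes "p \<in> coord_simplex I"
  shows "(\<Sum>j\<in>J. p $ j) \<le> of_bool (\<exists>b\<in>J. b \<in> I)"
proof (cases "\<exists>b\<in>J. b \<in> I")
  case True
  have "(\<Sum>j\<in>J. p $ j) \<le> (\<Sum>j\<in>UNIV. p $ j)"
    using assms coord_simplex_subset[of I] by (intro sum_mono2) auto
  then show ?thesis
    using assms coord_simplex_subset[of I] True by auto
next
  case False
  then have "(\<Sum>j\<in>J. p $ j) = 0"
    using assms coord_simplex_subset[of I] by (intro sum.neutral) auto
  then show ?thesis
    by simp
qed

text \<open>A point of a simplex has mass at most 1 on \<open>J\<close>, and none if its vertex set
  misses \<open>J\<close>. These necessary conditions suffice here: the converse for lattice points
  comes from \<open>hypertree_realizable\<close>.\<close>

lemma gen_permutohedronD: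
  fixes G :: "('m::finite \<times> 'n::finite) set"
  assumes "p \<in> gen_permutohedron G"
  shows "(\<Sum>j\<in>UNIV. p $ j) = real CARD('m)"
    "(\<Sum>j\<in>J. p $ j) \<le> real (card (left_nbrs UNIV G J))"
proof -
  obtain s where s: "p = sum s UNIV" "\<And>i. s i \<in> coord_simplex (nbrs G i)"
    using assms by (auto simp: gen_permutohedron_def set_sum_alt)
  have p: "(\<Sum>j\<in>J. p $ j) = (\<Sum>i\<in>UNIV. \<Sum>j\<in>J. s i $ j)" for J
    by (subst sum.swap) (simp add: s)
  have "(\<Sum>j\<in>UNIV. s i $ j) = 1" for i
    using s(2)[of i] coord_simplex_subset by blast
  then show "(\<Sum>j\<in>UNIV. p $ j) = real CARD('m)"
    by (simp add: p)
  have "(\<Sum>j\<in>J. p $ j) \<le> (\<Sum>i\<in>UNIV. of_bool (\<exists>b\<in>J. b \<in> nbrs G i))"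
    unfolding p by (intro sum_mono sum_coord_simplex_le s)
  also have "\<dots> = real (card (left_nbrs UNIV G J))"
    by (simp add: left_nbrs_def nbrs_def of_bool_def sum.If_cases)
  finally show "(\<Sum>j\<in>J. p $ j) \<le> real (card (left_nbrs UNIV G J))" .
qed

lemma convex_gen_permutohedron: "convex (gen_permutohedron G)"
proof -
  have "gen_permutohedron G = convex hull (\<Sum>i\<in>UNIV. (\<lambda>j. axis j 1) ` nbrs G i)"
    unfolding gen_permutohedron_def coord_simplex_def by (simp add: convex_hull_set_sum)
  then show ?thesis
    by simp
qed

lemma realizable_in_gen_permutohedron:
  fixes G :: "('m::finite \<times> 'n::finite) set"
  assumes "realizable G UNIV x"
  shows "(\<chi> j. of_int (x j)) \<in> gen_permutohedron G"
proof -
  obtain \<phi> where \<phi>: "\<And>a. (a, \<phi> a) \<in> G" "\<And>b. int (card {a. \<phi> a = b}) = x b"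
    using assms by (auto simp: realizable_def)
  have "(\<chi> j. of_int (x j)) = (\<Sum>i\<in>UNIV. axis (\<phi> i) 1 :: real ^ 'n)"
    by (auto simp: vec_eq_iff axis_def sum.If_cases eq_commute simp flip: \<phi>(2))
  moreover have "axis (\<phi> i) 1 \<in> coord_simplex (nbrs G i)" for i
    unfolding coord_simplex_def using \<phi>(1) by (intro hull_inc) (auto simp: nbrs_def)
  ultimately show ?thesis
    by (auto simp: gen_permutohedron_def set_sum_alt)
qed

text \<open>By convexity, a translated simplex lies in the polytope as soon as its vertices
  do.\<close>

lemma trimmed_iff:
  "x \<in> trimmed_gen_permutohedron G \<longleftrightarrow> (\<forall>j. x + axis j 1 \<in> gen_permutohedron G)"
proof
  assume "x \<in> trimmed_gen_permutohedron G"
  then show "\<forall>j. x + axis j 1 \<in> gen_permutohedron G"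
    by (auto simp: trimmed_gen_permutohedron_def coord_simplex_def image_subset_iff hull_inc)
next
  assume *: "\<forall>j. x + axis j 1 \<in> gen_permutohedron G"
  have "(\<lambda>y. x + y) ` coord_simplex UNIV = convex hull ((\<lambda>y. x + y) ` range (\<lambda>j. axis j 1))"
    unfolding coord_simplex_def by (rule convex_hull_translation[symmetric])
  also have "\<dots> \<subseteq> gen_permutohedron G"
    using * by (intro hull_minimal convex_gen_permutohedron) auto
  finally show "x \<in> trimmed_gen_permutohedron G"
    by (simp add: trimmed_gen_permutohedron_def)
qed

lemma lattice_points_trimmed:
  fixes G :: "('m::finite \<times> 'n::finite) set"
  shows "lattice_points (trimmed_gen_permutohedron G)
    = (\<lambda>x. \<chi> j. of_int (x j)) ` hypertrees UNIV UNIV G"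
proof (intro equalityI subsetI)
  fix p assume p: "p \<in> lattice_points (trimmed_gen_permutohedron G)"
  define x where "x j = \<lfloor>p $ j\<rfloor>" for j
  have px: "p $ j = of_int (x j)" for j
    using p by (auto simp: lattice_points_def x_def)
  have in_P: "p + axis k 1 \<in> gen_permutohedron G" for k
    using p by (auto simp: lattice_points_def trimmed_iff)
  have sum: "(\<Sum>j\<in>J. (p + axis k 1) $ j) = of_int (sum x J + of_bool (k \<in> J))" for J k
    by (auto simp: px sum.distrib axis_def)
  have "x \<in> hypertrees UNIV UNIV G"
    unfolding hypertrees_def mem_Collect_eq
  proof (intro conjI allI impI)
    \<comment> \<open>Any unit vector raises the total by 1, so \<open>undefined\<close> serves as
      an arbitrary coordinate.\<close>
    have "real_of_int (sum x UNIV + 1) = of_int (int CARD('m))"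
      using gen_permutohedronD(1)[OF in_P] sum[where J = UNIV and k = undefined] by simp
    then show "sum x UNIV = int CARD('m) - 1"
      by linarith
    fix J :: "'n set" assume "J \<subseteq> UNIV \<and> J \<noteq> {}"
    \<comment> \<open>Shifting by a coordinate inside \<open>J\<close> raises the sum over
      \<open>J\<close> by 1, which turns the weak bound into the strict one.\<close>
    then obtain k where "k \<in> J"
      by auto
    then have "real_of_int (sum x J + 1) \<le> of_int (int (card (left_nbrs UNIV G J)))"
      using gen_permutohedronD(2)[OF in_P[of k], of J] sum[where J = J and k = k] by simp
    then show "sum x J < int (card (left_nbrs UNIV G J))"
      by linarith
  qed auto
  moreover have "p = (\<chi> j. of_int (x j))"
    by (simp add: vec_eq_iff px)
  ultimately show "p \<in> (\<lambda>x. \<chi> j. of_int (x j)) ` hypertrees UNIV UNIV G"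
    by blast
next
  fix p :: "real ^ 'n" assume "p \<in> (\<lambda>x. \<chi> j. of_int (x j)) ` hypertrees UNIV UNIV G"
  then obtain x where x: "x \<in> hypertrees UNIV UNIV G" and p: "p = (\<chi> j. of_int (x j))"
    by auto
  have "p + axis k 1 \<in> gen_permutohedron G" for k
  proof -
    \<comment> \<open>This is the version rooted at the right vertex \<open>k\<close>: it realizes
      the translate by the \<open>k\<close>-th vertex of the simplex.\<close>
    have "realizable G UNIV (\<lambda>b. x b + of_bool (b = k))"
      using hypertree_realizable[OF _ _ _ x] by auto
    moreover have "p + axis k 1 = (\<chi> j. of_int (x j + of_bool (j = k)))"
      by (auto simp: p vec_eq_iff axis_def)
    ultimately show ?thesis
      using realizable_in_gen_permutohedron by metis
  qed
  then show "p \<in> lattice_points (trimmed_gen_permutohedron G)"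
    by (auto simp: lattice_points_def trimmed_iff p)
qed

lemma card_lattice_points_trimmed:
  fixes G :: "('m::finite \<times> 'n::finite) set"
  shows "card (lattice_points (trimmed_gen_permutohedron G)) = card (hypertrees UNIV UNIV G)"
  unfolding lattice_points_trimmed
  by (rule card_image) (auto simp: inj_on_def vec_eq_iff)

theorem corollary11p8:
  fixes G :: "('m::finite \<times> 'n::finite) set"
  assumes "no_isolated_vertices G"
  shows "card (lattice_points (trimmed_gen_permutohedron G))
       = card (lattice_points (trimmed_gen_permutohedron (G\<inverse>)))"
  unfolding card_lattice_points_trimmed by (rule card_hypertrees_converse) simp_all

end
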